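(* Let $G$ be a connected irregular simple graph with $n$ vertices, $m$ edges and maximum degree $\Delta$, and let $\alpha \in [0,1]$. Then $$\lambda_1(A_\alpha(G)) < \Delta - \frac{1-\alpha}{2n(n\Delta - 1)\Delta^2}.$$
   Context: For a simple graph $G$ with adjacency matrix $A(G)$ and diagonal degree matrix $D(G)$, and $\alpha\in[0,1]$, define $A_\alpha(G) = \alpha D(G) + (1-\alpha)A(G)$. Its eigenvalues are ordered $\lambda_1(A_\alpha(G)) \ge \dots \ge \lambda_n(A_\alpha(G))$. A graph is irregular if its vertex degrees take at least two distinct values.
   Formalization: The range of α is restricted from [0,1] to [0,1), because at α = 1 the matrix is the diagonal degree matrix, so λ₁ = Δ equals the right-hand side and the strict inequality fails for every graph. *)

theory Defs
  imports
    "Graph_Theory.Graph_Theory"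
    "Jordan_Normal_Form.Spectral_Radius"
begin

text \<open>
  Simple graphs are the locale \<^locale>\<open>graph\<close>: finite, loop-free, without parallel arcs, and
  symmetric.  Each undirected edge is a pair of opposite arcs, so the degree of a vertex is its
  \<^const>\<open>out_degree\<close>, and a graph with \<open>m\<close> edges has \<open>2 * m\<close> arcs.

  The matrices are taken with respect to a list \<open>vs\<close> enumerating the vertices without repetition;
  row and column \<open>i\<close> belong to the vertex \<open>vs ! i\<close>.
\<close>

definition adjacency_mat :: "('a, 'b) pre_digraph \<Rightarrow> 'a list \<Rightarrow> real mat" where
  "adjacency_mat G vs =
     mat (length vs) (length vs) (\<lambda>(i, j). if vs ! i \<rightarrow>\<^bsub>G\<^esub> vs ! j then 1 else 0)"

definition degree_mat :: "('a, 'b) pre_digraph \<Rightarrow> 'a list \<Rightarrow> real mat" where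
  "degree_mat G vs =
     mat (length vs) (length vs) (\<lambda>(i, j). if i = j then real (out_degree G (vs ! i)) else 0)"

definition A_alpha :: "real \<Rightarrow> ('a, 'b) pre_digraph \<Rightarrow> 'a list \<Rightarrow> real mat" where
  "A_alpha \<alpha> G vs = \<alpha> \<cdot>\<^sub>m degree_mat G vs + (1 - \<alpha>) \<cdot>\<^sub>m adjacency_mat G vs"

text \<open>
  Only meant for real symmetric matrices of positive dimension, whose spectrum is finite, nonempty
  and entirely real.
\<close>

definition lambda1 :: "real mat \<Rightarrow> real" where
  "lambda1 A = Max (spectrum A)"

definition max_degree :: "('a, 'b) pre_digraph \<Rightarrow> nat" where
  "max_degree G = Max (out_degree G ` verts G)"

definition irregular :: "('a, 'b) pre_digraph \<Rightarrow> bool" where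
  "irregular G \<longleftrightarrow> (\<exists>u \<in> verts G. \<exists>v \<in> verts G. out_degree G u \<noteq> out_degree G v)"

end

theory Submission
  imports Defs
begin

text \<open>
  Let \<open>f\<close> be an eigenfunction of \<open>A\<^sub>\<alpha>\<close> for the eigenvalue \<open>\<theta>\<close>.  Then
  \<open>(\<Delta> - \<theta>) * (\<Sum>u. f(u)\<^sup>2) = (\<Sum>u. (\<Delta> - d(u)) * f(u)\<^sup>2) + (1 - \<alpha>) * (\<Sum>uv. (f(u) - f(v))\<^sup>2)\<close>,
  the last sum ranging over the edges.  Choose \<open>s\<close> maximising \<open>\<bar>f\<bar>\<close> and \<open>t\<close> with \<open>d(t) < \<Delta>\<close>.  The
  Cauchy-Schwarz inequality along a path from \<open>s\<close> to \<open>t\<close> shows that \<open>f(t)\<^sup>2\<close> and the edge sum cannot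
  both be small compared with \<open>f(s)\<^sup>2\<close>, which gives \<open>\<Delta> - \<theta> \<ge> (1 - \<alpha>) / (n * (2 * n - 1))\<close>.
  As \<open>\<Delta> \<ge> 2\<close> for a connected irregular graph, this is stronger than the claimed bound.
\<close>

section \<open>Real eigenvalues of symmetric matrices\<close>

text \<open>Makes the \<open>Max\<close> in \<open>lambda1\<close> meaningful. A complex eigenvalue
  always exists; symmetry forces it to be real, and it is then a root of the real characteristic
  polynomial.\<close>

lemma spectrum_nonempty_real_symmetric:
  fixes A :: "real mat"
  assumes A: "A \<in> carrier_mat n n" and n: "n > 0" and sym: "transpose_mat A = A"
  shows "spectrum A \<noteq> {}"
proof -
  let ?B = "map_mat complex_of_real A"
  have B: "?B \<in> carrier_mat n n" using A by simp
  obtain k where k: "eigenvalue ?B k"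
    using spectrum_non_empty[OF B n] by (auto simp: spectrum_def)
  then obtain v where v: "v \<in> carrier_vec n" and v0: "v \<noteq> 0\<^sub>v n" and ev: "?B *\<^sub>v v = k \<cdot>\<^sub>v v"
    using B by (auto simp: eigenvalue_def eigenvector_def)
  have cv: "conjugate v \<in> carrier_vec n" using v by simp
  have Bsym: "transpose_mat ?B = ?B"
    using sym by (metis map_mat_transpose)
  have cev: "?B *\<^sub>v conjugate v = cnj k \<cdot>\<^sub>v conjugate v"
  proof -
    have "?B *\<^sub>v conjugate v = conjugate (?B *\<^sub>v v)"
      using A v by (intro eq_vecI) (auto simp: scalar_prod_def)
    also have "\<dots> = cnj k \<cdot>\<^sub>v conjugate v"
      unfolding ev using v by (intro eq_vecI) auto
    finally show ?thesis .
  qed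
  \<comment> \<open>The Hermitian form of \<open>?B\<close> at \<open>v\<close> is evaluated in two
    ways, moving \<open>?B\<close> to the second factor by symmetry. As
    \<open>v \<bullet>c v\<close> is nonzero, \<open>k\<close> equals its conjugate.\<close>
  have "k * (v \<bullet>c v) = (?B *\<^sub>v v) \<bullet>c v"
    unfolding ev using v cv by simp
  also have "\<dots> = v \<bullet> (?B *\<^sub>v conjugate v)"
    using transpose_vec_mult_scalar[OF B cv v] Bsym by simp
  also have "\<dots> = cnj k * (v \<bullet>c v)"
    unfolding cev using v cv by simp
  finally have "k = cnj k" using v v0 by simp
  then have kr: "k = complex_of_real (Re k)" by (metis Reals_cnj_iff of_real_Re)
  have "complex_of_real (poly (char_poly A) (Re k)) = poly (char_poly ?B) k"
    using kr by (metis of_real_hom.char_poly_hom[OF A] of_real_hom.poly_map_poly)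
  also have "\<dots> = 0" using k eigenvalue_root_char_poly[OF B] by simp
  finally have "poly (char_poly A) (Re k) = 0" by simp
  then show ?thesis using spectrum_root_char_poly[OF A] by auto
qed

section \<open>Squared differences along walks\<close>

text \<open>Cauchy-Schwarz in the form (a + b)^2 \<le> (k + 1) (a^2 + b^2 / k), while k = 0 forces b
  = 0. The bound \<open>S\<close> in place of b^2 / k lets the inequality be iterated along a
  walk.\<close>

lemma square_add_le:
  fixes a b k S :: real
  assumes "b\<^sup>2 \<le> k * S" and "k \<ge> 0" and "S \<ge> 0"
  shows "(a + b)\<^sup>2 \<le> (k + 1) * (a\<^sup>2 + S)"
proof (cases "k = 0")
  case True
  then show ?thesis using assms by simp
next
  case False
  then have k: "k > 0" using assms by simp
  then have "b\<^sup>2 / k \<le> S" using assms(1) by (simp add: field_simps)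
  moreover have "2 * a * b \<le> k * a\<^sup>2 + b\<^sup>2 / k"
  proof -
    have "0 \<le> (k * a - b)\<^sup>2 / k" using k by simp
    also have "\<dots> = k * a\<^sup>2 + b\<^sup>2 / k - 2 * a * b"
      using k by (simp add: power2_eq_square field_simps)
    finally show ?thesis by simp
  qed
  ultimately show ?thesis using assms(1)
    by (simp add: power2_eq_square algebra_simps)
qed

text \<open>The sum ranges over arcs, so every edge is counted twice.\<close>

definition (in pre_digraph) dirichlet :: "('a \<Rightarrow> real) \<Rightarrow> real" where
  "dirichlet f = (\<Sum>e\<in>arcs G. (f (tail G e) - f (head G e))\<^sup>2)"

text \<open>Cauchy-Schwarz for a telescoping sum: by \<open>square_add_le\<close>, each further arc
  raises the constant by one.\<close>

lemma (in wf_digraph) awalk_square_diff_le: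
  fixes f :: "'a \<Rightarrow> real"
  assumes "awalk u p v"
  shows "(f u - f v)\<^sup>2 \<le> real (length p) * (\<Sum>e\<leftarrow>p. (f (tail G e) - f (head G e))\<^sup>2)"
  using assms
proof (induction p arbitrary: u)
  case Nil
  then show ?case by (simp add: awalk_Nil_iff)
next
  case (Cons e p)
  then have u: "u = tail G e" and "awalk (head G e) p v" by (auto simp: awalk_Cons_iff)
  note IH = Cons.IH[OF this(2)]
  have S: "0 \<le> (\<Sum>e\<leftarrow>p. (f (tail G e) - f (head G e))\<^sup>2)"
    by (intro sum_list_nonneg) auto
  show ?case
    using square_add_le[OF IH, of "f u - f (head G e)"] S u by (simp add: add.commute)
qed

text \<open>A path has at most n - 1 arcs and repeats none, so its squared differences are part of
  the sum over all arcs.\<close>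

lemma (in fin_digraph) square_diff_le_dirichlet:
  assumes "u \<rightarrow>\<^sup>* v"
  shows "(f u - f v)\<^sup>2 \<le> (real (card (verts G)) - 1) * dirichlet f"
proof -
  obtain p where p: "apath u p v" using assms reachable_apath by auto
  then have walk: "awalk u p v" and "distinct p"
    by (auto intro: awalkI_apath simp: apath_def distinct_verts_imp_distinct)
  have "(\<Sum>e\<leftarrow>p. (f (tail G e) - f (head G e))\<^sup>2) = (\<Sum>e\<in>set p. (f (tail G e) - f (head G e))\<^sup>2)"
    using \<open>distinct p\<close> by (simp add: sum_list_distinct_conv_sum_set)
  also have "\<dots> \<le> dirichlet f"
    unfolding dirichlet_def using walk by (intro sum_mono2) (auto simp: awalk_def)
  finally have "(\<Sum>e\<leftarrow>p. (f (tail G e) - f (head G e))\<^sup>2) \<le> dirichlet f" .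
  moreover have "0 \<le> (\<Sum>e\<leftarrow>p. (f (tail G e) - f (head G e))\<^sup>2)"
    by (intro sum_list_nonneg) auto
  moreover have "real (length p) \<le> real (card (verts G)) - 1"
    using length_apath_less[OF p] by linarith
  ultimately have "real (length p) * (\<Sum>e\<leftarrow>p. (f (tail G e) - f (head G e))\<^sup>2)
      \<le> (real (card (verts G)) - 1) * dirichlet f"
    by (intro mult_mono) auto
  then show ?thesis using awalk_square_diff_le[OF walk, of f] by linarith
qed

section \<open>Arc sums and the Laplacian\<close>

lemma (in fin_digraph) sum_arcs_by_tail:
  "(\<Sum>e\<in>arcs G. g e) = (\<Sum>u\<in>verts G. \<Sum>e\<in>out_arcs G u. g e)"
  using sum.group[of "arcs G" "verts G" "tail G" g]
  by (simp add: out_arcs_def image_subset_iff)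

text \<open>Without parallel arcs, arcs correspond to their pairs of ends, and by symmetry swapping
  the ends permutes these pairs.\<close>

lemma (in graph) sum_arcs_head_eq_tail:
  "(\<Sum>e\<in>arcs G. g (head G e)) = (\<Sum>e\<in>arcs G. g (tail G e))"
proof -
  have "(\<Sum>e\<in>arcs G. g (head G e)) = (\<Sum>(u, v)\<in>arcs_ends G. g v)"
    unfolding arcs_ends_def by (subst sum.reindex[OF inj_on_arc_to_ends]) (simp add: arc_to_ends_def)
  also have "\<dots> = (\<Sum>(u, v)\<in>arcs_ends G. g u)"
    by (rule sum.reindex_bij_witness[of _ prod.swap prod.swap])
      (auto intro: arcs_ends_symmetric[OF sym_arcs])
  also have "\<dots> = (\<Sum>e\<in>arcs G. g (tail G e))"
    unfolding arcs_ends_def by (subst sum.reindex[OF inj_on_arc_to_ends]) (simp add: arc_to_ends_def)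
  finally show ?thesis .
qed

text \<open>The quadratic form of the Laplacian D - A. When the square is expanded, heads and tails
  contribute equally, which cancels the factor 1/2.\<close>

lemma (in graph) dirichlet_eq:
  "dirichlet f / 2 = (\<Sum>u\<in>verts G. real (out_degree G u) * (f u)\<^sup>2)
     - (\<Sum>u\<in>verts G. f u * (\<Sum>e\<in>out_arcs G u. f (head G e)))"
proof -
  have "dirichlet f = (\<Sum>e\<in>arcs G. (f (tail G e))\<^sup>2) + (\<Sum>e\<in>arcs G. (f (head G e))\<^sup>2)
      - 2 * (\<Sum>e\<in>arcs G. f (tail G e) * f (head G e))"
    unfolding dirichlet_def sum_distrib_left
    by (simp add: power2_diff sum.distrib sum_subtractf mult.assoc)
  then have "dirichlet f / 2 = (\<Sum>e\<in>arcs G. (f (tail G e))\<^sup>2)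
      - (\<Sum>e\<in>arcs G. f (tail G e) * f (head G e))"
    using sum_arcs_head_eq_tail[of "\<lambda>v. (f v)\<^sup>2"] by simp
  then show ?thesis
    unfolding sum_arcs_by_tail by (simp add: out_degree_def sum_distrib_left)
qed

text \<open>Turns row sums of the adjacency matrix into arc sums; without parallel arcs, out-arcs
  and out-neighbours correspond one to one.\<close>

lemma (in digraph) sum_dominated:
  fixes g :: "'a \<Rightarrow> real"
  shows "(\<Sum>v\<in>verts G. if u \<rightarrow> v then g v else 0) = (\<Sum>e\<in>out_arcs G u. g (head G e))"
proof -
  have inj: "inj_on (head G) (out_arcs G u)"
    by (rule inj_onI) (auto intro: no_multi_arcs simp: arc_to_ends_def)
  have "(\<Sum>v\<in>verts G. if u \<rightarrow> v then g v else 0) = (\<Sum>v\<in>{v \<in> verts G. u \<rightarrow> v}. g v)"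
    by (simp add: sum.If_cases Int_def)
  also have "{v \<in> verts G. u \<rightarrow> v} = head G ` out_arcs G u"
    by (auto simp: arcs_ends_conv)
  also have "(\<Sum>v\<in>head G ` out_arcs G u. g v) = (\<Sum>e\<in>out_arcs G u. g (head G e))"
    by (simp add: sum.reindex[OF inj])
  finally show ?thesis .
qed

section \<open>The matrix and its eigenfunctions\<close>

lemma A_alpha_carrier: "A_alpha \<alpha> G vs \<in> carrier_mat (length vs) (length vs)"
  by (simp add: A_alpha_def adjacency_mat_def degree_mat_def)

lemma A_alpha_index:
  assumes "i < length vs" and "j < length vs"
  shows "A_alpha \<alpha> G vs $$ (i, j) =
    \<alpha> * (if i = j then real (out_degree G (vs ! i)) else 0)
      + (1 - \<alpha>) * (if vs ! i \<rightarrow>\<^bsub>G\<^esub> vs ! j then 1 else 0)"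
  using assms by (simp add: A_alpha_def adjacency_mat_def degree_mat_def)

lemma (in graph) A_alpha_symmetric: "transpose_mat (A_alpha \<alpha> G vs) = A_alpha \<alpha> G vs"
  using A_alpha_carrier[of \<alpha> G vs] arcs_ends_symmetric[OF sym_arcs]
  by (intro eq_matI) (auto simp: A_alpha_index)

lemma (in graph) A_alpha_eigenfunction:
  assumes ev: "eigenvalue (A_alpha \<alpha> G vs) \<theta>"
    and vs: "distinct vs" "set vs = verts G"
  obtains f where "\<exists>u\<in>verts G. f u \<noteq> 0"
    and "\<And>u. u \<in> verts G \<Longrightarrow>
      \<theta> * f u = \<alpha> * real (out_degree G u) * f u + (1 - \<alpha>) * (\<Sum>e\<in>out_arcs G u. f (head G e))"
proof -
  let ?n = "length vs" and ?A = "A_alpha \<alpha> G vs"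
  have A: "?A \<in> carrier_mat ?n ?n" by (rule A_alpha_carrier)
  obtain x where x: "x \<in> carrier_vec ?n" "x \<noteq> 0\<^sub>v ?n" and eq: "?A *\<^sub>v x = \<theta> \<cdot>\<^sub>v x"
    using ev A by (auto simp: eigenvalue_def eigenvector_def)
  have bij: "bij_betw ((!) vs) {..<?n} (verts G)"
    using vs by (metis bij_betw_nth)
  \<comment> \<open>The coordinate of \<open>x\<close> at the position of \<open>v\<close> in
    \<open>vs\<close>, which is unique for each vertex.\<close>
  define f where "f v = x $ inv_into {..<?n} ((!) vs) v" for v
  have f: "f (vs ! i) = x $ i" if "i < ?n" for i
    unfolding f_def using inv_into_f_f[of "(!) vs" "{..<?n}" i] bij that
    by (simp add: bij_betw_def)
  show thesis
  proof
    obtain i where "i < ?n" "x $ i \<noteq> 0"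
      using x by (metis carrier_vecD eq_vecI index_zero_vec)
    then show "\<exists>u\<in>verts G. f u \<noteq> 0" using f vs nth_mem by metis
  next
    fix u assume "u \<in> verts G"
    then obtain i where i: "i < ?n" "u = vs ! i" using vs by (metis in_set_conv_nth)
    have "\<theta> * f u = (?A *\<^sub>v x) $ i" unfolding eq using i f x by simp
    also have "\<dots> = (\<Sum>j<?n. ?A $$ (i, j) * x $ j)"
      using A i x by (simp add: scalar_prod_def lessThan_atLeast0)
    also have "\<dots> = (\<Sum>j<?n. (if i = j then \<alpha> * real (out_degree G u) * f u else 0)
        + (1 - \<alpha>) * (if u \<rightarrow> vs ! j then f (vs ! j) else 0))"
      using i f by (intro sum.cong) (auto simp: A_alpha_index algebra_simps)
    also have "\<dots> = \<alpha> * real (out_degree G u) * f u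
        + (1 - \<alpha>) * (\<Sum>j<?n. if u \<rightarrow> vs ! j then f (vs ! j) else 0)"
      using i by (simp add: sum.distrib sum_distrib_left)
    also have "(\<Sum>j<?n. if u \<rightarrow> vs ! j then f (vs ! j) else 0)
        = (\<Sum>v\<in>verts G. if u \<rightarrow> v then f v else 0)"
      by (rule sum.reindex_bij_betw[OF bij])
    finally show "\<theta> * f u = \<alpha> * real (out_degree G u) * f u
        + (1 - \<alpha>) * (\<Sum>e\<in>out_arcs G u. f (head G e))"
      unfolding sum_dominated .
  qed
qed

section \<open>Connectedness and degrees\<close>

lemma (in graph) connected_reachable:
  assumes "Digraph_Component.connected G" "u \<in> verts G" "v \<in> verts G"
  shows "u \<rightarrow>\<^sup>* v"
  using assms reachable_mk_symmetric_eq[OF sym_arcs]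
  by (simp add: connected_def strongly_connected_def)

lemma (in fin_digraph) out_degree_le_max_degree:
  "u \<in> verts G \<Longrightarrow> out_degree G u \<le> max_degree G"
  by (simp add: max_degree_def)

lemma (in fin_digraph) irregular_lower_degree:
  assumes "irregular G"
  obtains t where "t \<in> verts G" and "out_degree G t < max_degree G"
  using assms out_degree_le_max_degree unfolding irregular_def
  by (metis le_neq_implies_less)

text \<open>A vertex below the maximum degree still has a neighbour, since the graph is connected
  and has another vertex. Its degree is thus at least 1, and the maximum exceeds it.\<close>

lemma (in graph) max_degree_ge_2:
  assumes conn: "Digraph_Component.connected G" and "irregular G"
  shows "max_degree G \<ge> 2"
proof -
  obtain t where t: "t \<in> verts G" "out_degree G t < max_degree G"
    using irregular_lower_degree[OF assms(2)] .
  obtain u where u: "u \<in> verts G" "u \<noteq> t"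
    using assms(2) t(1) by (auto simp: irregular_def)
  from connected_reachable[OF conn t(1) u(1)] u(2) obtain w where "t \<rightarrow> w"
    by (cases rule: converse_reachable_cases) auto
  then have "out_arcs G t \<noteq> {}" by (auto simp: arcs_ends_conv)
  then have "out_degree G t \<ge> 1"
    using finite_out_arcs[of t] by (simp add: out_degree_def Suc_le_eq card_gt_0_iff)
  with t(2) show ?thesis by linarith
qed

section \<open>The spectral gap\<close>

lemma (in graph) A_alpha_eigenvalue_gap:
  assumes conn: "Digraph_Component.connected G" and irr: "irregular G"
    and vs: "distinct vs" "set vs = verts G"
    and \<alpha>: "0 \<le> \<alpha>" "\<alpha> \<le> 1"
    and ev: "eigenvalue (A_alpha \<alpha> G vs) \<theta>"
  defines "n \<equiv> real (card (verts G))"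
  shows "\<theta> \<le> real (max_degree G) - (1 - \<alpha>) / (n * (2 * n - 1))"
proof -
  let ?D = "real (max_degree G)" and ?d = "\<lambda>u. real (out_degree G u)"
  obtain f where nz: "\<exists>u\<in>verts G. f u \<noteq> 0" and f: "\<And>u. u \<in> verts G \<Longrightarrow>
      \<theta> * f u = \<alpha> * ?d u * f u + (1 - \<alpha>) * (\<Sum>e\<in>out_arcs G u. f (head G e))"
    using A_alpha_eigenfunction[OF ev vs] by blast
  define N where "N = (\<Sum>u\<in>verts G. (f u)\<^sup>2)"
  have N: "N > 0" unfolding N_def using nz by (auto intro: sum_pos2)
  have n: "n \<ge> 1" using nz by (auto simp: n_def Suc_le_eq card_gt_0_iff)
  have S: "dirichlet f \<ge> 0" by (simp add: dirichlet_def sum_nonneg)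
  obtain t where t: "t \<in> verts G" "out_degree G t < max_degree G"
    using irregular_lower_degree[OF irr] .
  have "Max ((\<lambda>u. \<bar>f u\<bar>) ` verts G) \<in> (\<lambda>u. \<bar>f u\<bar>) ` verts G"
    using t by (intro Max_in) auto
  then obtain s where s: "s \<in> verts G" and fs_Max: "Max ((\<lambda>u. \<bar>f u\<bar>) ` verts G) = \<bar>f s\<bar>"
    by (rule imageE)
  have s_max: "\<bar>f u\<bar> \<le> \<bar>f s\<bar>" if "u \<in> verts G" for u
    using that by (simp flip: fs_Max)
  have "(f s - f t)\<^sup>2 \<le> (2 * (n - 1)) * (dirichlet f / 2)"
    using square_diff_le_dirichlet[OF connected_reachable[OF conn s t(1)], of f]
    by (simp add: n_def algebra_simps)
  \<comment> \<open>Here f(s) is f(t) plus the difference, and k = 2 (n - 1) because the edge sum is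
    half of \<open>dirichlet f\<close>; hence the constant k + 1 = 2 n - 1.\<close>
  from square_add_le[OF this, of "f t"] n S
  have fs: "(f s)\<^sup>2 \<le> (2 * n - 1) * ((f t)\<^sup>2 + dirichlet f / 2)"
    by (simp add: algebra_simps)
  have "N \<le> (\<Sum>u\<in>verts G. (f s)\<^sup>2)"
    unfolding N_def using s_max by (intro sum_mono) (simp add: abs_le_square_iff)
  also have "\<dots> = n * (f s)\<^sup>2" by (simp add: n_def)
  also have "\<dots> \<le> n * ((2 * n - 1) * ((f t)\<^sup>2 + dirichlet f / 2))"
    using fs n by (intro mult_left_mono) auto
  finally have N_le: "N \<le> n * (2 * n - 1) * ((f t)\<^sup>2 + dirichlet f / 2)"
    by (simp add: mult.assoc)
  have "\<theta> * N = (\<Sum>u\<in>verts G. f u * (\<theta> * f u))"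
    by (simp add: N_def sum_distrib_left power2_eq_square mult_ac)
  also have "\<dots> = (\<Sum>u\<in>verts G. \<alpha> * (?d u * (f u)\<^sup>2)
      + (1 - \<alpha>) * (f u * (\<Sum>e\<in>out_arcs G u. f (head G e))))"
    by (intro sum.cong) (simp_all add: f power2_eq_square algebra_simps)
  also have "\<dots> = \<alpha> * (\<Sum>u\<in>verts G. ?d u * (f u)\<^sup>2)
      + (1 - \<alpha>) * (\<Sum>u\<in>verts G. f u * (\<Sum>e\<in>out_arcs G u. f (head G e)))"
    by (simp add: sum.distrib sum_distrib_left)
  \<comment> \<open>The adjacency form is the degree form minus the edge sum, so the weights
    \<alpha> and 1 - \<alpha> of the degree form add up to 1.\<close>
  also have "\<dots> = (\<Sum>u\<in>verts G. ?d u * (f u)\<^sup>2) - (1 - \<alpha>) * (dirichlet f / 2)"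
    unfolding dirichlet_eq by (simp add: algebra_simps)
  finally have "(?D - \<theta>) * N = (\<Sum>u\<in>verts G. (?D - ?d u) * (f u)\<^sup>2) + (1 - \<alpha>) * (dirichlet f / 2)"
    by (simp add: N_def sum_distrib_left sum_subtractf algebra_simps)
  moreover have "(f t)\<^sup>2 \<le> (\<Sum>u\<in>verts G. (?D - ?d u) * (f u)\<^sup>2)"
  proof -
    \<comment> \<open>Degrees are integers, so \<open>t\<close> falls short of the maximum by at
      least 1.\<close>
    have "1 * (f t)\<^sup>2 \<le> (?D - ?d t) * (f t)\<^sup>2"
      using t(2) by (intro mult_right_mono) auto
    also have "\<dots> \<le> (\<Sum>u\<in>verts G. (?D - ?d u) * (f u)\<^sup>2)"
      using t(1) out_degree_le_max_degree by (intro member_le_sum) auto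
    finally show ?thesis by simp
  qed
  \<comment> \<open>This weakening gives both terms the common factor 1 - \<alpha>, so that
    \<open>N_le\<close> can be applied.\<close>
  moreover have "(1 - \<alpha>) * (f t)\<^sup>2 \<le> (f t)\<^sup>2"
    using \<alpha> by (intro mult_left_le_one_le) auto
  ultimately have gap: "(1 - \<alpha>) * ((f t)\<^sup>2 + dirichlet f / 2) \<le> (?D - \<theta>) * N"
    by (simp add: distrib_left)
  have c: "n * (2 * n - 1) > 0" using n by simp
  have "(1 - \<alpha>) * N \<le> (1 - \<alpha>) * (n * (2 * n - 1) * ((f t)\<^sup>2 + dirichlet f / 2))"
    using N_le \<alpha> by (intro mult_left_mono) auto
  also have "\<dots> = n * (2 * n - 1) * ((1 - \<alpha>) * ((f t)\<^sup>2 + dirichlet f / 2))"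
    by simp
  also have "\<dots> \<le> n * (2 * n - 1) * ((?D - \<theta>) * N)"
    using gap c by (intro mult_left_mono) auto
  finally have "(1 - \<alpha>) * N \<le> ((?D - \<theta>) * (n * (2 * n - 1))) * N"
    by (simp add: mult_ac)
  then have "1 - \<alpha> \<le> (?D - \<theta>) * (n * (2 * n - 1))"
    using N by simp
  then have "(1 - \<alpha>) / (n * (2 * n - 1)) \<le> ?D - \<theta>"
    using c by (simp add: pos_divide_le_eq)
  then show ?thesis by simp
qed

section \<open>Comparison with the claimed bound\<close>

theorem theorem3p2:
  fixes G :: "('a, 'b) pre_digraph" and vs :: "'a list"
    and n m \<Delta> :: nat and \<alpha> :: real
  assumes "graph G"
    and "Digraph_Component.connected G"
    and "irregular G"
    and "distinct vs" and "set vs = verts G"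
    and "n = card (verts G)"
    and "2 * m = card (arcs G)"
    and "\<Delta> = max_degree G"
    and "0 \<le> \<alpha>" and "\<alpha> < 1"
  shows "lambda1 (A_alpha \<alpha> G vs)
           < real \<Delta> - (1 - \<alpha>) / (2 * real n * (real n * real \<Delta> - 1) * (real \<Delta>)\<^sup>2)"
proof -
  interpret graph G by fact
  let ?A = "A_alpha \<alpha> G vs"
  have len: "length vs = n" using assms(4-6) by (metis distinct_card)
  have n: "real n \<ge> 1"
    using assms(3,6) by (auto simp: irregular_def Suc_le_eq card_gt_0_iff)
  have "spectrum ?A \<noteq> {}"
    using spectrum_nonempty_real_symmetric[OF A_alpha_carrier _ A_alpha_symmetric] len n
    by (metis of_nat_0 not_gr_zero not_one_le_zero)
  \<comment> \<open>The maximum of a finite nonempty set is attained, so the gap applies to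
    \<open>lambda1 ?A\<close>.\<close>
  then have "lambda1 ?A \<in> spectrum ?A"
    unfolding lambda1_def using card_finite_spectrum(1)[OF A_alpha_carrier] by (intro Max_in)
  then have le: "lambda1 ?A \<le> real \<Delta> - (1 - \<alpha>) / (real n * (2 * real n - 1))"
    using A_alpha_eigenvalue_gap[OF assms(2-5)] assms(6,8-10) by (simp add: spectrum_def)
  have \<Delta>: "real \<Delta> \<ge> 2" using max_degree_ge_2[OF assms(2,3)] assms(8) by simp
  \<comment> \<open>The claimed denominator is the larger one: \<Delta> \<ge> 2 gives 2 n \<le> n
    \<Delta>, and the remaining factor 2 \<Delta>^2 exceeds 1.\<close>
  have le': "2 * real n - 1 \<le> real n * real \<Delta> - 1" using \<Delta> n by (simp add: mult.commute)
  also have "\<dots> < (real n * real \<Delta> - 1) * (2 * (real \<Delta>)\<^sup>2)"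
  proof -
    have "1 < 2 * (real \<Delta>)\<^sup>2" using power_mono[OF \<Delta>, of 2] by simp
    moreover have "0 < real n * real \<Delta> - 1" using le' n by linarith
    ultimately show ?thesis by simp
  qed
  finally have "real n * (2 * real n - 1) < 2 * real n * (real n * real \<Delta> - 1) * (real \<Delta>)\<^sup>2"
    using n mult_strict_left_mono[of _ _ "real n"] by (fastforce simp: algebra_simps)
  moreover have "0 < real n * (2 * real n - 1)" using n by simp
  \<comment> \<open>Strictness rests on \<alpha> < 1: for \<alpha> = 1 the matrix is the diagonal
    degree matrix, whose largest eigenvalue is \<Delta> itself.\<close>
  ultimately have "(1 - \<alpha>) / (2 * real n * (real n * real \<Delta> - 1) * (real \<Delta>)\<^sup>2)
      < (1 - \<alpha>) / (real n * (2 * real n - 1))"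
    using assms(10) by (smt (verit) divide_strict_left_mono mult_pos_pos)
  with le show ?thesis by linarith
qed

end
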